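(* Let $\mathcal{X},\mathcal{Y}$ be real, Hausdorff, locally convex topological vector spaces, and let $\leq$ be any binary relation on $\mathcal{Y}$ (the canonical total order if $\mathcal{Y}=\mathbb{R}$), extended to $\overline{\mathcal{Y}}=\mathcal{Y}\cup\{\pm\infty\}$. Let $\Omega_1,\Omega_2$ be sets, let $\mathcal{S}_1,\mathcal{S}_2$ be vector spaces of real-valued functions on $\Omega_1$ and $\Omega_2$ containing the unit constant functions, and let $\mathcal{E}\colon\mathcal{S}_1\to\mathcal{S}_2$ be a Markov operator. Let $\mathcal{E}^{\mathcal{X}}\colon\mathcal{S}_1^{\mathcal{X}}\to\mathcal{S}_2^{\mathcal{X}}$ and $\mathcal{E}^{\mathcal{Y}}\colon\mathcal{S}_1^{\mathcal{Y}}\to\mathcal{S}_2^{\mathcal{Y}}$ be an $\mathcal{X}$-valued and a $\mathcal{Y}$-valued Markov operator, respectively, both associated with the same Markov operator $\mathcal{E}$. Let $K\subseteq\mathcal{X}$, $f\colon K\to\mathcal{Y}$ and $X\colon\Omega_1\to K$ be such that $(X,f(X))\in\mathcal{S}_1^{\mathcal{X}}\times\mathcal{S}_1^{\mathcal{Y}}$. Let $g_l,g_u\colon\overline{\operatorname{Conv}(K)}\to\overline{\mathcal{Y}}$ be functions such that $$\overline{\operatorname{Conv}(\mathcal{G}(f))}\subseteq\{(x,y)\in\overline{\operatorname{Conv}(K)}\times\mathcal{Y} \mid g_l(x)\leq y\leq g_u(x)\},$$ i.e. $\overline{\operatorname{Conv}(\mathcal{G}(f))}|_x\subseteq[g_l(x),g_u(x)]$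 for each $x\in\overline{\operatorname{Conv}(K)}$. Then $$g_l(\mathcal{E}^{\mathcal{X}}(X))\leq\mathcal{E}^{\mathcal{Y}}(f(X))\leq g_u(\mathcal{E}^{\mathcal{X}}(X)),$$ where all objects are functions on $\Omega_2$ and the relations hold pointwise on $\Omega_2$.
   Context: Markov operators: a linear operator $\mathcal{E}\colon\mathcal{S}_1\to\mathcal{S}_2$ is a Markov operator if (i) $\mathcal{E}(\mathbf{1}_{\Omega_1})=\mathbf{1}_{\Omega_2}$, where $\mathbf{1}_{\Omega_i}$ is the constant function $1$ on $\Omega_i$, and (ii) $\mathcal{E}(\varphi)\geq0$ for each $\varphi\in\mathcal{S}_1$ with $\varphi\geq0$ (pointwise). For a real topological vector space $\mathcal{Z}$ with continuous dual $\mathcal{Z}'$, let, for $i=1,2$, $\mathcal{S}_i^{\mathcal{Z}}$ be any subset of $\{Z_i\colon\Omega_i\to\mathcal{Z}\mid \ell(Z_i)=\ell\circ Z_i\in\mathcal{S}_i\text{ for each }\ell\in\mathcal{Z}'\}$. A map $\mathcal{E}^{\mathcal{Z}}\colon\mathcal{S}_1^{\mathcal{Z}}\to\mathcal{S}_2^{\mathcal{Z}}$ is a $\mathcal{Z}$-valued Markov operator associated with $\mathcal{E}$ if $\ell(\mathcal{E}^{\mathcal{Z}}(Z_1))=\mathcal{E}(\ell(Z_1))$ for each $\ell\in\mathcal{Z}'$ and $Z_1\in\mathcal{S}_1^{\mathcal{Z}}$. The sets $\mathcal{S}_i^{\mathcal{X}},\mathcal{S}_i^{\mathcal{Y}}$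 are of this form with $\mathcal{Z}=\mathcal{X},\mathcal{Y}$. No measurability or integrability is assumed. Notation: $f(X)$ denotes $f\circ X$; $\overline{A}$ is the closure, $\operatorname{Conv}(A)$ the convex hull of $A$; $\mathcal{G}(f)=\{(x,f(x))\mid x\in K\}$ is the graph of $f$. For $M\subseteq\mathcal{X}\times\mathcal{Y}$ and $x\in\mathcal{X}$, $M|_x:=\{y\in\mathcal{Y}\mid(x,y)\in M\}$; $\overline{\operatorname{Conv}(\mathcal{G}(f))}|_x$ is the section of the closed set $\overline{\operatorname{Conv}(\mathcal{G}(f))}$. The elements $\pm\infty$ of $\overline{\mathcal{Y}}$ satisfy $-\infty\leq y\leq\infty$ for each $y\in\mathcal{Y}$, and $[a,b]:=\{y\in\overline{\mathcal{Y}}\mid a\leq y\leq b\}$. *)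

theory Defs
  imports "HOL-Analysis.Analysis" "HOL-Library.Extended"
begin

text \<open>Real topological vector spaces: in addition to the group operations, scalar multiplication
  is jointly continuous (stated as in the class \<^class>\<open>topological_monoid_add\<close>).\<close>

class real_topological_vector = real_vector + topological_ab_group_add +
  assumes tendsto_scaleR_Pair:
    "LIM p (nhds c \<times>\<^sub>F nhds x). fst p *\<^sub>R snd p :> nhds (c *\<^sub>R x)"

text \<open>By translation invariance it suffices to have convex neighbourhood bases at the origin.
  Class assumptions cannot mention \<^const>\<open>convex\<close>, so its definition is unfolded here; see
  \<open>convex_neighbourhood_base\<close> below for the intended form.\<close>

class hausdorff_locally_convex = real_topological_vector + t2_space +
  assumes locally_convex:
    "open U \<Longrightarrow> 0 \<in> U \<Longrightarrow>
      \<exists>V. open V \<and>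
        (\<forall>x\<in>V. \<forall>y\<in>V. \<forall>u\<ge>0. \<forall>v\<ge>0. u + v = 1 \<longrightarrow> u *\<^sub>R x + v *\<^sub>R y \<in> V) \<and>
        0 \<in> V \<and> V \<subseteq> U"

lemma convex_neighbourhood_base:
  fixes U :: "'z::hausdorff_locally_convex set"
  assumes "open U" "0 \<in> U"
  shows "\<exists>V. open V \<and> convex V \<and> 0 \<in> V \<and> V \<subseteq> U"
  using locally_convex[OF assms] unfolding convex_def .

instance real_normed_vector \<subseteq> hausdorff_locally_convex
proof
  fix c :: real and x :: 'a
  show "LIM p (nhds c \<times>\<^sub>F nhds x). fst p *\<^sub>R snd p :> nhds (c *\<^sub>R x)"
    by (intro tendsto_scaleR filterlim_fst filterlim_snd)
next
  fix U :: "'a set"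
  assume "open U" "0 \<in> U"
  then obtain e where "e > 0" "ball 0 e \<subseteq> U"
    by (meson open_contains_ball)
  then have "open (ball (0::'a) e) \<and> convex (ball (0::'a) e) \<and> 0 \<in> ball (0::'a) e \<and> ball 0 e \<subseteq> U"
    by simp
  then show "\<exists>V. open V \<and>
      (\<forall>x\<in>V. \<forall>y\<in>V. \<forall>u\<ge>0. \<forall>v\<ge>0. u + v = 1 \<longrightarrow> u *\<^sub>R x + v *\<^sub>R y \<in> V) \<and> 0 \<in> V \<and> V \<subseteq> U"
    unfolding convex_def by blast
qed

definition continuous_dual :: "('z::real_topological_vector \<Rightarrow> real) set" where
  "continuous_dual = {l. linear l \<and> continuous_on UNIV l}"

text \<open>Functions on a set \<open>\<Omega>\<close> are represented by their extensional versions
  (\<^const>\<open>extensional\<close>), so that equality of representatives is equality on \<open>\<Omega>\<close>, and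
  \<open>compose \<Omega> l Z\<close> is the function \<open>l \<circ> Z\<close> on \<open>\<Omega>\<close>.\<close>

definition function_space :: "'w set \<Rightarrow> ('w \<Rightarrow> real) set \<Rightarrow> bool" where
  "function_space \<Omega> S \<longleftrightarrow>
     S \<subseteq> extensional \<Omega> \<and>
     (\<lambda>\<omega>\<in>\<Omega>. 1) \<in> S \<and>
     (\<forall>\<phi>\<in>S. \<forall>\<psi>\<in>S. (\<lambda>\<omega>\<in>\<Omega>. \<phi> \<omega> + \<psi> \<omega>) \<in> S) \<and>
     (\<forall>c. \<forall>\<phi>\<in>S. (\<lambda>\<omega>\<in>\<Omega>. c * \<phi> \<omega>) \<in> S)"

definition markov_operator ::
  "'a set \<Rightarrow> ('a \<Rightarrow> real) set \<Rightarrow> 'b set \<Rightarrow> ('b \<Rightarrow> real) set \<Rightarrow>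
   (('a \<Rightarrow> real) \<Rightarrow> ('b \<Rightarrow> real)) \<Rightarrow> bool" where
  "markov_operator \<Omega>1 S1 \<Omega>2 S2 E \<longleftrightarrow>
     E \<in> S1 \<rightarrow> S2 \<and>
     (\<forall>\<phi>\<in>S1. \<forall>\<psi>\<in>S1. E (\<lambda>\<omega>\<in>\<Omega>1. \<phi> \<omega> + \<psi> \<omega>) = (\<lambda>\<omega>\<in>\<Omega>2. E \<phi> \<omega> + E \<psi> \<omega>)) \<and>
     (\<forall>c. \<forall>\<phi>\<in>S1. E (\<lambda>\<omega>\<in>\<Omega>1. c * \<phi> \<omega>) = (\<lambda>\<omega>\<in>\<Omega>2. c * E \<phi> \<omega>)) \<and>
     E (\<lambda>\<omega>\<in>\<Omega>1. 1) = (\<lambda>\<omega>\<in>\<Omega>2. 1) \<and>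
     (\<forall>\<phi>\<in>S1. (\<forall>\<omega>\<in>\<Omega>1. 0 \<le> \<phi> \<omega>) \<longrightarrow> (\<forall>\<omega>\<in>\<Omega>2. 0 \<le> E \<phi> \<omega>))"

definition weak_functions ::
  "'w set \<Rightarrow> ('w \<Rightarrow> real) set \<Rightarrow> ('w \<Rightarrow> 'z::real_topological_vector) set" where
  "weak_functions \<Omega> S = {Z \<in> extensional \<Omega>. \<forall>l\<in>continuous_dual. compose \<Omega> l Z \<in> S}"

definition valued_markov_operator ::
  "'a set \<Rightarrow> ('a \<Rightarrow> real) set \<Rightarrow> ('a \<Rightarrow> 'z::real_topological_vector) set \<Rightarrow>
   'b set \<Rightarrow> ('b \<Rightarrow> real) set \<Rightarrow> ('b \<Rightarrow> 'z) set \<Rightarrow>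
   (('a \<Rightarrow> real) \<Rightarrow> ('b \<Rightarrow> real)) \<Rightarrow> (('a \<Rightarrow> 'z) \<Rightarrow> ('b \<Rightarrow> 'z)) \<Rightarrow> bool" where
  "valued_markov_operator \<Omega>1 S1 S1Z \<Omega>2 S2 S2Z E E_Z \<longleftrightarrow>
     S1Z \<subseteq> weak_functions \<Omega>1 S1 \<and>
     S2Z \<subseteq> weak_functions \<Omega>2 S2 \<and>
     E_Z \<in> S1Z \<rightarrow> S2Z \<and>
     (\<forall>l\<in>continuous_dual. \<forall>Z\<in>S1Z. compose \<Omega>2 l (E_Z Z) = E (compose \<Omega>1 l Z))"

definition graph_on :: "'x set \<Rightarrow> ('x \<Rightarrow> 'y) \<Rightarrow> ('x \<times> 'y) set" where
  "graph_on K f = {(x, f x) | x. x \<in> K}"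

text \<open>\<open>rel'\<close> extends the binary relation \<open>rel\<close> to the type extended by two infinite elements.
  Only comparisons of finite elements with the infinite ones are prescribed; the remaining
  comparisons (such as those between infinite elements) are left open.\<close>

definition extends_relation ::
  "('y \<Rightarrow> 'y \<Rightarrow> bool) \<Rightarrow> ('y extended \<Rightarrow> 'y extended \<Rightarrow> bool) \<Rightarrow> bool" where
  "extends_relation rel rel' \<longleftrightarrow>
     (\<forall>a b. rel' (Fin a) (Fin b) \<longleftrightarrow> rel a b) \<and>
     (\<forall>y. rel' Minf (Fin y) \<and> rel' (Fin y) Pinf)"

lemma extends_relation_order: "extends_relation (\<le>) ((\<le>) :: 'y::order extended \<Rightarrow> _)"
  by (simp add: extends_relation_def)

end

theory Submission
  imports Defs
begin

text \<open>The pair \<open>(E_X X \<omega>, E_Y (f \<circ> X) \<omega>)\<close> lies in the closed convex hull of the graph of \<open>f\<close>;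
  the sandwich assumption then applies to it directly.

  Suppose it did not lie there. The product of the two spaces is again locally convex, so a
  continuous linear functional \<open>l\<close> on it strictly separates the pair \<open>z\<close> from the graph:
  \<open>l z + 1 \<le> l (x, f x)\<close> for all \<open>x \<in> K\<close> (lemma \<open>strict_separation\<close>). Splitting
  \<open>l (x, y) = l (x, 0) + l (0, y)\<close> makes \<open>l (X, f \<circ> X) - (l z + 1)\<close> a nonnegative element of \<open>S1\<close>,
  and \<open>E\<close> maps it to a function whose value at \<open>\<omega>\<close> is \<open>l z - (l z + 1) = -1\<close>, contradicting
  positivity.

  Strict separation is a form of the Hahn-Banach theorem. By Zorn's lemma there is a minimal
  sublinear functional below any given one, and a minimal sublinear functional is linear
  (lemma \<open>sublinear_dominates_linear\<close>). This is applied to the sublinear functional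
  \<open>r x = inf {s - t | x = s u + t (z - c), s, t \<ge> 0, u \<in> U, c \<in> C}\<close>, where \<open>U\<close> is a convex
  neighbourhood of the origin such that \<open>z + U\<close> does not meet the convex set \<open>C\<close>. A linear functional
  below \<open>r\<close> is at most \<open>1\<close> on \<open>U\<close>, hence continuous, and at most \<open>-1\<close> on \<open>z - C\<close>, hence separating.\<close>

section \<open>Linear functionals below sublinear ones\<close>

text \<open>Sublinear functionals, with positive homogeneity required only as an inequality because that
  is easier to check: the inequality for \<open>a = 0\<close> gives \<open>p 0 \<le> 0\<close>, and subadditivity gives \<open>p 0 \<ge> 0\<close>; using the
  inequality for \<open>1 / a\<close> as well, this is positive homogeneity \<open>p (a *\<^sub>R x) = a * p x\<close>.\<close>

definition sublinear :: "('z::real_vector \<Rightarrow> real) \<Rightarrow> bool" where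
  "sublinear p \<longleftrightarrow>
     (\<forall>x y. p (x + y) \<le> p x + p y) \<and> (\<forall>a\<ge>0. \<forall>x. p (a *\<^sub>R x) \<le> a * p x)"

lemma sublinear_add: "sublinear p \<Longrightarrow> p (x + y) \<le> p x + p y"
  by (simp add: sublinear_def)

lemma sublinear_scaleR_le: "sublinear p \<Longrightarrow> 0 \<le> a \<Longrightarrow> p (a *\<^sub>R x) \<le> a * p x"
  by (simp add: sublinear_def)

lemma sublinear_zero: "sublinear p \<Longrightarrow> p 0 = 0"
  using sublinear_add[of p 0 0] sublinear_scaleR_le[of p 0 0] by simp

lemma sublinear_scaleR:
  assumes p: "sublinear p" and "0 \<le> a"
  shows "p (a *\<^sub>R x) = a * p x"
proof (cases "a = 0")
  case True
  then show ?thesis using p by (simp add: sublinear_zero)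
next
  case False
  with \<open>0 \<le> a\<close> have "0 < a" by simp
  have "p ((1 / a) *\<^sub>R (a *\<^sub>R x)) \<le> (1 / a) * p (a *\<^sub>R x)"
    using p \<open>0 \<le> a\<close> by (intro sublinear_scaleR_le) auto
  then have "a * p x \<le> p (a *\<^sub>R x)"
    using \<open>0 < a\<close> by (simp add: field_simps)
  then show ?thesis
    using sublinear_scaleR_le[OF p \<open>0 \<le> a\<close>, of x] by linarith
qed

lemma sublinear_lower_bound: "sublinear p \<Longrightarrow> - p (- x) \<le> p x"
  using sublinear_add[of p x "- x"] sublinear_zero[of p] by simp

text \<open>The set \<open>A x\<close> collects the upper bounds allowed at \<open>x\<close>. The functional \<open>Inf (A x)\<close> is subadditive
  as soon as a sum of bounds at \<open>x\<close> and \<open>y\<close> can be matched or improved by a bound at \<open>x + y\<close>.\<close>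

lemma sublinear_Inf:
  fixes A :: "'z::real_vector \<Rightarrow> real set"
  assumes ne: "\<And>x. A x \<noteq> {}" and bdd: "\<And>x. bdd_below (A x)"
    and add: "\<And>x y a b. a \<in> A x \<Longrightarrow> b \<in> A y \<Longrightarrow> \<exists>c\<in>A (x + y). c \<le> a + b"
    and scale: "\<And>x a k. a \<in> A x \<Longrightarrow> 0 < k \<Longrightarrow> k * a \<in> A (k *\<^sub>R x)"
    and zero: "\<exists>a\<in>A 0. a \<le> 0"
  shows "sublinear (\<lambda>x. Inf (A x))"
  unfolding sublinear_def
proof (intro conjI allI impI)
  fix x y
  have "Inf (A (x + y)) - b \<le> a" if ab: "a \<in> A x" "b \<in> A y" for a b
  proof -
    obtain c where "c \<in> A (x + y)" "c \<le> a + b"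
      using add[OF ab] by blast
    then show ?thesis using cInf_lower[OF _ bdd, of c "x + y"] by linarith
  qed
  then have "Inf (A (x + y)) - b \<le> Inf (A x)" if "b \<in> A y" for b
    using that by (intro cInf_greatest ne) auto
  then have "Inf (A (x + y)) - Inf (A x) \<le> b" if "b \<in> A y" for b
    using that by fastforce
  then have "Inf (A (x + y)) - Inf (A x) \<le> Inf (A y)"
    by (intro cInf_greatest ne)
  then show "Inf (A (x + y)) \<le> Inf (A x) + Inf (A y)" by linarith
next
  fix k :: real and x
  assume "0 \<le> k"
  show "Inf (A (k *\<^sub>R x)) \<le> k * Inf (A x)"
  proof (cases "k = 0")
    case True
    obtain a where "a \<in> A 0" "a \<le> 0"
      using zero by blast
    then show ?thesis
      using cInf_lower[OF _ bdd, of a 0] True by simp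
  next
    case False
    with \<open>0 \<le> k\<close> have k: "0 < k" by simp
    have "Inf (A (k *\<^sub>R x)) / k \<le> a" if "a \<in> A x" for a
      using cInf_lower[OF scale[OF that k] bdd] k by (simp add: field_simps)
    then have "Inf (A (k *\<^sub>R x)) / k \<le> Inf (A x)"
      by (intro cInf_greatest ne)
    then show ?thesis using k by (simp add: field_simps)
  qed
qed

lemma minimal_sublinear_exists:
  fixes q :: "'z::real_vector \<Rightarrow> real"
  assumes q: "sublinear q"
  shows "\<exists>p. sublinear p \<and> p \<le> q \<and> (\<forall>r. sublinear r \<longrightarrow> r \<le> p \<longrightarrow> r = p)"
proof -
  define F where "F = {p. sublinear p \<and> p \<le> q}"
  have "\<exists>m\<in>F. \<forall>a\<in>F. a \<le> m \<longrightarrow> a = m"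
  proof (rule predicate_Zorn[where P = "\<lambda>a b. b \<le> a"])
    show "partial_order_on F (relation_of (\<lambda>a b. b \<le> a) F)"
      by (rule partial_order_on_relation_ofI) auto
    fix Ch assume "Ch \<in> Chains (relation_of (\<lambda>a b. b \<le> a) F)"
    then have sub: "Ch \<subseteq> F" and chain: "\<And>a b. a \<in> Ch \<Longrightarrow> b \<in> Ch \<Longrightarrow> a \<le> b \<or> b \<le> a"
      unfolding Chains_def relation_of_def by auto
    show "\<exists>u\<in>F. \<forall>a\<in>Ch. u \<le> a"
    proof (cases "Ch = {}")
      case True
      then show ?thesis using q by (auto simp: F_def)
    next
      case False
      have sl: "sublinear p" "p x \<le> q x" if "p \<in> Ch" for p x
        using sub that by (auto simp: F_def le_fun_def)
      have bdd: "bdd_below ((\<lambda>p. p x) ` Ch)" for x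
      proof (rule bdd_belowI2)
        fix p assume "p \<in> Ch"
        then show "- q (- x) \<le> p x"
          using sublinear_lower_bound[OF sl(1), of p x] sl(2)[of p "- x"] by linarith
      qed
      have "sublinear (\<lambda>x. Inf ((\<lambda>p. p x) ` Ch))"
      proof (rule sublinear_Inf)
        fix x y a b
        assume "a \<in> (\<lambda>p. p x) ` Ch" "b \<in> (\<lambda>p. p y) ` Ch"
        then obtain p p' where p: "p \<in> Ch" "a = p x" and p': "p' \<in> Ch" "b = p' y"
          by auto
        \<comment> \<open>The smaller of the two functionals bounds both values.\<close>
        obtain m where m: "m \<in> Ch" "m \<le> p" "m \<le> p'"
          using chain[of p p'] p p' by auto
        have "m (x + y) \<le> m x + m y"
          by (rule sublinear_add[OF sl(1)[OF m(1)]])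
        also have "\<dots> \<le> a + b"
          using m(2,3) unfolding p(2) p'(2) le_fun_def by (intro add_mono) auto
        finally have "m (x + y) \<le> a + b" .
        then show "\<exists>c\<in>(\<lambda>p. p (x + y)) ` Ch. c \<le> a + b"
          using m by auto
      next
        fix x a and k :: real
        assume "a \<in> (\<lambda>p. p x) ` Ch" "0 < k"
        then show "k * a \<in> (\<lambda>p. p (k *\<^sub>R x)) ` Ch"
          using sl(1) by (force simp: sublinear_scaleR)
      next
        show "\<exists>a\<in>(\<lambda>p. p 0) ` Ch. a \<le> 0"
          using False sl(1) sublinear_zero by fastforce
      qed (use False bdd in auto)
      moreover have lower: "Inf ((\<lambda>p. p x) ` Ch) \<le> p x" if "p \<in> Ch" for p x
        using bdd that by (intro cInf_lower) auto
      moreover have "Inf ((\<lambda>p. p x) ` Ch) \<le> q x" for x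
      proof -
        obtain p where "p \<in> Ch" using False by blast
        then show ?thesis using lower[of p x] sl(2)[of p x] by linarith
      qed
      ultimately show ?thesis
        by (intro bexI[of _ "\<lambda>x. Inf ((\<lambda>p. p x) ` Ch)"]) (auto simp: F_def le_fun_def)
    qed
  qed
  then obtain m where m: "m \<in> F" "\<And>a. a \<in> F \<Longrightarrow> a \<le> m \<Longrightarrow> a = m" by blast
  have "r = m" if "sublinear r" "r \<le> m" for r
    using m that by (auto simp: F_def)
  with m(1) show ?thesis by (auto simp: F_def)
qed

text \<open>For fixed \<open>y\<close>, the functional \<open>x \<mapsto> inf {p (x + t y) - t p y | t \<ge> 0}\<close> is sublinear and below
  \<open>p\<close>, so that it equals \<open>p\<close> when \<open>p\<close> is minimal. Taking \<open>t = 1\<close> gives superadditivity.\<close>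

lemma minimal_sublinear_linear:
  fixes p :: "'z::real_vector \<Rightarrow> real"
  assumes p: "sublinear p" and min: "\<And>r. sublinear r \<Longrightarrow> r \<le> p \<Longrightarrow> r = p"
  shows "linear p"
proof -
  have super: "p x + p y \<le> p (x + y)" for x y
  proof -
    define A where "A = (\<lambda>x. (\<lambda>t. p (x + t *\<^sub>R y) - t * p y) ` {0..})"
    have bdd: "bdd_below (A x)" for x
      unfolding A_def
    proof (rule bdd_belowI2)
      fix t :: real assume t: "t \<in> {0..}"
      have "p (t *\<^sub>R y) \<le> p (x + t *\<^sub>R y) + p (- x)"
        using sublinear_add[OF p, of "x + t *\<^sub>R y" "- x"] by simp
      then show "- p (- x) \<le> p (x + t *\<^sub>R y) - t * p y"
        using t p by (simp add: sublinear_scaleR)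
    qed
    have lower: "Inf (A x) \<le> p (x + t *\<^sub>R y) - t * p y" if "0 \<le> t" for x t
      using bdd that by (intro cInf_lower) (auto simp: A_def)
    have "sublinear (\<lambda>x. Inf (A x))"
    proof (rule sublinear_Inf)
      fix x x' a b
      assume "a \<in> A x" "b \<in> A x'"
      then obtain t t' where t: "0 \<le> t" "0 \<le> t'"
        and ab: "a = p (x + t *\<^sub>R y) - t * p y" "b = p (x' + t' *\<^sub>R y) - t' * p y"
        by (auto simp: A_def)
      have "(x + x') + (t + t') *\<^sub>R y = (x + t *\<^sub>R y) + (x' + t' *\<^sub>R y)"
        by (simp add: algebra_simps)
      then have "p ((x + x') + (t + t') *\<^sub>R y) - (t + t') * p y \<le> a + b"
        using sublinear_add[OF p, of "x + t *\<^sub>R y" "x' + t' *\<^sub>R y"] ab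
        by (simp add: algebra_simps)
      then show "\<exists>c\<in>A (x + x'). c \<le> a + b"
        using t unfolding A_def by (intro bexI[OF _ imageI[where x = "t + t'"]]) auto
    next
      fix x a and k :: real
      assume "a \<in> A x" and k: "0 < k"
      then obtain t where t: "0 \<le> t" and a: "a = p (x + t *\<^sub>R y) - t * p y"
        by (auto simp: A_def)
      have "p (k *\<^sub>R x + (k * t) *\<^sub>R y) = k * p (x + t *\<^sub>R y)"
        using sublinear_scaleR[OF p, of k "x + t *\<^sub>R y"] k by (simp add: algebra_simps)
      then have "k * a = p (k *\<^sub>R x + (k * t) *\<^sub>R y) - (k * t) * p y"
        unfolding a by (simp add: right_diff_distrib)
      then show "k * a \<in> A (k *\<^sub>R x)"
        using t k unfolding A_def by (intro image_eqI[where x = "k * t"]) auto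
    next
      show "\<exists>a\<in>A 0. a \<le> 0"
        unfolding A_def using sublinear_zero[OF p] by (intro bexI[OF _ imageI[of 0]]) auto
    next
      show "A x \<noteq> {}" for x by (auto simp: A_def)
    qed (rule bdd)
    moreover have "(\<lambda>x. Inf (A x)) \<le> p"
      using lower[of 0] by (simp add: le_fun_def)
    ultimately have "Inf (A x) = p x"
      using min by metis
    then show ?thesis using lower[of 1 x] by simp
  qed
  have add: "p (x + y) = p x + p y" for x y
    using super sublinear_add[OF p] by (simp add: order_antisym)
  have neg: "p (- x) = - p x" for x
    using add[of x "- x"] sublinear_zero[OF p] by simp
  have "p (a *\<^sub>R x) = a * p x" for a x
  proof (cases "0 \<le> a")
    case True
    then show ?thesis by (rule sublinear_scaleR[OF p])
  next
    case False
    then show ?thesis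
      using sublinear_scaleR[OF p, of "- a" x] neg[of "a *\<^sub>R x"] by simp
  qed
  with add show ?thesis by (intro linearI) auto
qed

lemma sublinear_dominates_linear:
  fixes q :: "'z::real_vector \<Rightarrow> real"
  assumes "sublinear q"
  obtains l where "linear l" "\<And>x. l x \<le> q x"
proof -
  obtain p where p: "sublinear p" "p \<le> q" "\<And>r. sublinear r \<Longrightarrow> r \<le> p \<Longrightarrow> r = p"
    using minimal_sublinear_exists[OF assms] by blast
  show ?thesis
  proof (rule that)
    show "linear p" using p(1,3) by (rule minimal_sublinear_linear)
    show "p x \<le> q x" for x using p(2) by (rule le_funD)
  qed
qed

section \<open>Strict separation in locally convex spaces\<close>

lemma tendsto_scaleR_const:
  fixes g :: "'w \<Rightarrow> 'z::real_topological_vector"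
  assumes "(g \<longlongrightarrow> y) F"
  shows "((\<lambda>w. k *\<^sub>R g w) \<longlongrightarrow> k *\<^sub>R y) F"
  using filterlim_compose[OF tendsto_scaleR_Pair filterlim_Pair[OF tendsto_const assms]] by simp

lemma neighbourhood_of_0_absorbing:
  fixes U :: "'z::real_topological_vector set"
  assumes "open U" "0 \<in> U"
  shows "\<exists>s\<ge>0. \<exists>u\<in>U. x = s *\<^sub>R u"
proof -
  have "((\<lambda>n. (1 / real n) *\<^sub>R x) \<longlongrightarrow> 0 *\<^sub>R x) sequentially"
    using filterlim_compose[OF tendsto_scaleR_Pair filterlim_Pair[OF lim_1_over_n tendsto_const]]
    by simp
  then have "\<forall>\<^sub>F n in sequentially. (1 / real n) *\<^sub>R x \<in> U"
    using assms by (intro topological_tendstoD) auto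
  with eventually_gt_at_top[of 0] have "\<forall>\<^sub>F n in sequentially. 0 < n \<and> (1 / real n) *\<^sub>R x \<in> U"
    by eventually_elim auto
  then obtain n where "0 < n" "(1 / real n) *\<^sub>R x \<in> U"
    using eventually_happens'[OF sequentially_bot] by blast
  then show ?thesis
    by (intro exI[of _ "real n"] conjI bexI[of _ "(1 / real n) *\<^sub>R x"]) auto
qed

lemma bounded_above_linear_in_continuous_dual:
  fixes l :: "'z::real_topological_vector \<Rightarrow> real"
  assumes l: "linear l" and U: "open U" "0 \<in> U" and le: "\<And>u. u \<in> U \<Longrightarrow> l u \<le> 1"
  shows "l \<in> continuous_dual"
proof -
  have "(l \<longlongrightarrow> l x) (at x)" for x
  proof -
    have near: "\<forall>\<^sub>F y in at x. l (k *\<^sub>R (y - x)) \<le> 1" for k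
    proof -
      have "((\<lambda>y. k *\<^sub>R (y - x)) \<longlongrightarrow> k *\<^sub>R (x - x)) (at x)"
        by (intro tendsto_scaleR_const tendsto_diff tendsto_ident_at tendsto_const)
      then have "\<forall>\<^sub>F y in at x. k *\<^sub>R (y - x) \<in> U"
        using U by (intro topological_tendstoD) auto
      then show ?thesis by eventually_elim (rule le)
    qed
    \<comment> \<open>The factor \<open>2\<close> in the scalars below turns the weak bound into a strict one.\<close>
    show ?thesis
    proof (rule order_tendstoI)
      fix a assume a: "a < l x"
      show "\<forall>\<^sub>F y in at x. a < l y"
        using near[of "- 2 / (l x - a)"]
      proof eventually_elim
        case (elim y)
        then have "- 2 / (l x - a) * (l y - l x) \<le> 1"
          unfolding linear_scale[OF l] linear_diff[OF l] real_scaleR_def .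
        then have "2 * (l x - l y) \<le> l x - a"
          using a by (simp add: field_simps)
        moreover have "l x - a < 2 * (l x - a)"
          using a by simp
        ultimately have "2 * (l x - l y) < 2 * (l x - a)"
          by (rule order_le_less_trans)
        then show ?case by simp
      qed
    next
      fix a assume a: "l x < a"
      show "\<forall>\<^sub>F y in at x. l y < a"
        using near[of "2 / (a - l x)"]
      proof eventually_elim
        case (elim y)
        then have "2 / (a - l x) * (l y - l x) \<le> 1"
          unfolding linear_scale[OF l] linear_diff[OF l] real_scaleR_def .
        then have "2 * (l y - l x) \<le> a - l x"
          using a by (simp add: field_simps)
        moreover have "a - l x < 2 * (a - l x)"
          using a by simp
        ultimately have "2 * (l y - l x) < 2 * (a - l x)"
          by (rule order_le_less_trans)
        then show ?case by simp
      qed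
    qed
  qed
  then have "continuous_on UNIV l"
    by (simp add: continuous_on_def)
  with l show ?thesis by (simp add: continuous_dual_def)
qed

lemma convex_scaleR_add:
  assumes "convex U" "u \<in> U" "v \<in> U" "0 \<le> s" "0 \<le> t"
  shows "\<exists>w\<in>U. s *\<^sub>R u + t *\<^sub>R v = (s + t) *\<^sub>R w"
proof (cases "s + t = 0")
  case True
  then have "s = 0" "t = 0" using assms by auto
  then show ?thesis using assms by auto
next
  case False
  define w where "w = (s / (s + t)) *\<^sub>R u + (t / (s + t)) *\<^sub>R v"
  have "w \<in> U"
    unfolding w_def using assms False
    by (intro convexD) (auto simp: add_divide_distrib[symmetric])
  moreover have "s *\<^sub>R u + t *\<^sub>R v = (s + t) *\<^sub>R w"
    using False by (simp add: w_def scaleR_add_right)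
  ultimately show ?thesis by blast
qed

text \<open>A point outside the closure of a convex set is strictly separated from it; the gap is
  normalised to \<open>1\<close>. The set may be empty.\<close>

lemma strict_separation:
  fixes z :: "'z::hausdorff_locally_convex"
  assumes C: "convex C" and z: "z \<notin> closure C"
  obtains l where "l \<in> continuous_dual" "\<And>c. c \<in> C \<Longrightarrow> l z + 1 \<le> l c"
proof (cases "C = {}")
  case True
  have "(\<lambda>_::'z. 0) \<in> continuous_dual"
    by (auto simp: continuous_dual_def intro: linearI)
  then show ?thesis using that True by blast
next
  case False
  then obtain c0 where c0: "c0 \<in> C" by blast
  have "open ((\<lambda>w. z + w) -` (- closure C))"
    by (intro open_vimage continuous_on_add continuous_on_const continuous_on_id) auto
  then obtain U where U: "open U" "convex U" "0 \<in> U" "U \<subseteq> (\<lambda>w. z + w) -` (- closure C)"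
    using convex_neighbourhood_base[of "(\<lambda>w. z + w) -` (- closure C)"] z by auto
  have disj: "c - z \<notin> U" if "c \<in> C" for c
    using U(4) that closure_subset[of C] by fastforce

  \<comment> \<open>\<open>Inf (A x)\<close> is at most \<open>1\<close> for \<open>x \<in> U\<close> (take \<open>s = 1\<close>, \<open>t = 0\<close>) and at most \<open>-1\<close> for
    \<open>x = z - c\<close> with \<open>c \<in> C\<close> (take \<open>s = 0\<close>, \<open>t = 1\<close>).\<close>
  define A where "A = (\<lambda>x. {s - t | s t u c. 0 \<le> s \<and> 0 \<le> t \<and> u \<in> U \<and> c \<in> C \<and>
      x = s *\<^sub>R u + t *\<^sub>R (z - c)})"
  have AI: "s - t \<in> A x" if "0 \<le> s" "0 \<le> t" "u \<in> U" "c \<in> C" "x = s *\<^sub>R u + t *\<^sub>R (z - c)"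
    for x s t u c
    using that unfolding A_def by blast
  have ne: "A x \<noteq> {}" for x
  proof -
    obtain s u where "0 \<le> s" "u \<in> U" "x = s *\<^sub>R u"
      using neighbourhood_of_0_absorbing[OF U(1,3)] by blast
    then show ?thesis using AI[of s 0 u c0 x] c0 by auto
  qed
  have bdd: "bdd_below (A x)" for x
  proof -
    obtain s' u' where s': "0 \<le> s'" "u' \<in> U" "- x = s' *\<^sub>R u'"
      using neighbourhood_of_0_absorbing[OF U(1,3)] by blast
    \<comment> \<open>Adding the two representations of \<open>x\<close> and \<open>- x\<close> gives \<open>t (c - z) \<in> (s + s') U\<close>, which forces
      \<open>t \<le> s + s'\<close> since \<open>c - z\<close> lies outside \<open>U\<close>.\<close>
    have "- s' \<le> a" if "a \<in> A x" for a
    proof -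
      from that obtain s t u c where *: "0 \<le> s" "0 \<le> t" "u \<in> U" "c \<in> C"
        "x = s *\<^sub>R u + t *\<^sub>R (z - c)" and a: "a = s - t"
        by (auto simp: A_def)
      obtain w where w: "w \<in> U" "s *\<^sub>R u + s' *\<^sub>R u' = (s + s') *\<^sub>R w"
        using convex_scaleR_add[OF U(2)] * s' by meson
      have "t *\<^sub>R (c - z) = s *\<^sub>R u + s' *\<^sub>R u'"
        unfolding s'(3)[symmetric] *(5) by (simp add: algebra_simps)
      with w have eq: "t *\<^sub>R (c - z) = (s + s') *\<^sub>R w" by simp
      have "t \<le> s + s'"
      proof (rule ccontr)
        assume "\<not> t \<le> s + s'"
        then have t: "s + s' < t" "0 < t" using * s' by auto
        \<comment> \<open>Here \<open>c - z\<close> would be a multiple of \<open>w\<close> by a factor in \<open>[0, 1)\<close>, and so in \<open>U\<close>.\<close>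
        have "c - z = (1 / t) *\<^sub>R (t *\<^sub>R (c - z))"
          using t by simp
        also have "\<dots> = ((s + s') / t) *\<^sub>R w + (1 - (s + s') / t) *\<^sub>R 0"
          unfolding eq by simp
        also have "\<dots> \<in> U"
          using U(2,3) w(1) t * s' by (intro convexD) (auto simp: field_simps)
        finally show False using disj[OF *(4)] by blast
      qed
      then show ?thesis using a by simp
    qed
    then show ?thesis by (rule bdd_belowI)
  qed

  have "sublinear (\<lambda>x. Inf (A x))"
  proof (rule sublinear_Inf[OF ne bdd])
    fix x y a b
    assume "a \<in> A x" "b \<in> A y"
    then obtain s t u c s' t' u' c' where
      1: "0 \<le> s" "0 \<le> t" "u \<in> U" "c \<in> C" "x = s *\<^sub>R u + t *\<^sub>R (z - c)" "a = s - t" and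
      2: "0 \<le> s'" "0 \<le> t'" "u' \<in> U" "c' \<in> C" "y = s' *\<^sub>R u' + t' *\<^sub>R (z - c')" "b = s' - t'"
      unfolding A_def by blast
    obtain w where w: "w \<in> U" "s *\<^sub>R u + s' *\<^sub>R u' = (s + s') *\<^sub>R w"
      using convex_scaleR_add[OF U(2) 1(3) 2(3) 1(1) 2(1)] by blast
    obtain d where d: "d \<in> C" "t *\<^sub>R c + t' *\<^sub>R c' = (t + t') *\<^sub>R d"
      using convex_scaleR_add[OF C 1(4) 2(4) 1(2) 2(2)] by blast
    have "x + y = (s *\<^sub>R u + s' *\<^sub>R u') + ((t + t') *\<^sub>R z - (t *\<^sub>R c + t' *\<^sub>R c'))"
      unfolding 1(5) 2(5) by (simp add: algebra_simps)
    also have "\<dots> = (s + s') *\<^sub>R w + (t + t') *\<^sub>R (z - d)"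
      unfolding w(2) d(2) by (simp add: algebra_simps)
    finally have "(s + s') - (t + t') \<in> A (x + y)"
      using 1 2 w(1) d(1) by (intro AI) auto
    then show "\<exists>k\<in>A (x + y). k \<le> a + b"
      using 1 2 by (intro bexI) auto
  next
    fix x a and k :: real
    assume "a \<in> A x" and k: "0 < k"
    then obtain s t u c where *: "0 \<le> s" "0 \<le> t" "u \<in> U" "c \<in> C"
        "x = s *\<^sub>R u + t *\<^sub>R (z - c)" "a = s - t"
      by (auto simp: A_def)
    have "k * s - k * t \<in> A (k *\<^sub>R x)"
      using * k by (intro AI[of _ _ u c]) (auto simp: scaleR_add_right)
    then show "k * a \<in> A (k *\<^sub>R x)"
      using * by (simp add: right_diff_distrib)
  next
    have "0 - 0 \<in> A 0"
      using U(3) c0 by (intro AI[of _ _ 0 c0]) auto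
    then show "\<exists>a\<in>A 0. a \<le> 0" by auto
  qed
  then obtain l where l: "linear l" "\<And>x. l x \<le> Inf (A x)"
    by (rule sublinear_dominates_linear) blast
  have below: "l x \<le> a" if "a \<in> A x" for x a
    using l(2)[of x] cInf_lower[OF that bdd] by linarith
  have "l u \<le> 1" if "u \<in> U" for u
    using below[OF AI[of 1 0 u c0 u]] that c0 by simp
  then have "l \<in> continuous_dual"
    using bounded_above_linear_in_continuous_dual[OF l(1) U(1,3)] by blast
  moreover have "l z + 1 \<le> l c" if "c \<in> C" for c
    using below[OF AI[of 0 1 0 c "z - c"]] that U(3) l(1) by (simp add: linear_diff)
  ultimately show ?thesis by (rule that)
qed

section \<open>Products of locally convex spaces\<close>

instance prod :: (topological_monoid_add, topological_monoid_add) topological_monoid_add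
proof
  fix a b :: "'a \<times> 'b"
  have "((\<lambda>p. (fst (fst p) + fst (snd p), snd (fst p) + snd (snd p))) \<longlongrightarrow>
      (fst a + fst b, snd a + snd b)) (nhds a \<times>\<^sub>F nhds b)"
    by (intro tendsto_Pair tendsto_add tendsto_fst tendsto_snd filterlim_fst filterlim_snd)
  then show "LIM p (nhds a \<times>\<^sub>F nhds b). fst p + snd p :> nhds (a + b)"
    by (simp add: plus_prod_def)
qed

instance prod :: (topological_ab_group_add, topological_ab_group_add) topological_ab_group_add
proof
  fix a :: "'a \<times> 'b"
  have "((\<lambda>p. (- fst p, - snd p)) \<longlongrightarrow> (- fst a, - snd a)) (nhds a)"
    by (intro tendsto_Pair tendsto_minus tendsto_fst tendsto_snd filterlim_ident)
  then show "(uminus \<longlongrightarrow> - a) (nhds a)"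
    by (simp add: uminus_prod_def[abs_def])
qed

instance prod :: (real_topological_vector, real_topological_vector) real_topological_vector
proof
  fix c :: real and x :: "'a \<times> 'b"
  have scale: "((\<lambda>p. fst p *\<^sub>R g (snd p)) \<longlongrightarrow> c *\<^sub>R g x) (nhds c \<times>\<^sub>F nhds x)"
    if "(g \<longlongrightarrow> g x) (nhds x)" for g :: "'a \<times> 'b \<Rightarrow> 'w::real_topological_vector"
  proof -
    have "((\<lambda>p. g (snd p)) \<longlongrightarrow> g x) (nhds c \<times>\<^sub>F nhds x)"
      using filterlim_compose[OF that filterlim_snd] .
    from filterlim_compose[OF tendsto_scaleR_Pair filterlim_Pair[OF filterlim_fst this]]
    show ?thesis by simp
  qed
  have "((\<lambda>p. (fst p *\<^sub>R fst (snd p), fst p *\<^sub>R snd (snd p))) \<longlongrightarrow>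
      (c *\<^sub>R fst x, c *\<^sub>R snd x)) (nhds c \<times>\<^sub>F nhds x)"
    by (intro tendsto_Pair scale tendsto_fst tendsto_snd filterlim_ident)
  then show "LIM p (nhds c \<times>\<^sub>F nhds x). fst p *\<^sub>R snd p :> nhds (c *\<^sub>R x)"
    by (simp add: scaleR_prod_def)
qed

instance prod :: (hausdorff_locally_convex, hausdorff_locally_convex) hausdorff_locally_convex
proof
  fix U :: "('a \<times> 'b) set"
  assume "open U" "0 \<in> U"
  then obtain A B where "open A" "open B" "0 \<in> A" "0 \<in> B" and AB: "A \<times> B \<subseteq> U"
    by (elim open_prod_elim) (auto simp: zero_prod_def)
  obtain V where V: "open V" "convex V" "0 \<in> V" "V \<subseteq> A"
    using convex_neighbourhood_base[OF \<open>open A\<close> \<open>0 \<in> A\<close>] by blast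
  obtain W where W: "open W" "convex W" "0 \<in> W" "W \<subseteq> B"
    using convex_neighbourhood_base[OF \<open>open B\<close> \<open>0 \<in> B\<close>] by blast
  have "convex (V \<times> W)"
    using V(2) W(2) by (rule convex_Times)
  moreover have "open (V \<times> W)" "0 \<in> V \<times> W" "V \<times> W \<subseteq> U"
    using V W AB by (auto simp: zero_prod_def intro: open_Times)
  ultimately show "\<exists>V. open V \<and>
      (\<forall>x\<in>V. \<forall>y\<in>V. \<forall>u\<ge>0. \<forall>v\<ge>0. u + v = 1 \<longrightarrow> u *\<^sub>R x + v *\<^sub>R y \<in> V) \<and> 0 \<in> V \<and> V \<subseteq> U"
    by (intro exI[of _ "V \<times> W"]) (simp only: convex_def)
qed

lemma continuous_dual_prod_split:
  fixes l :: "'x::real_topological_vector \<times> 'y::real_topological_vector \<Rightarrow> real"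
  assumes "l \<in> continuous_dual"
  shows "(\<lambda>x. l (x, 0)) \<in> continuous_dual" "(\<lambda>y. l (0, y)) \<in> continuous_dual"
    and "l (x, y) = l (x, 0) + l (0, y)"
proof -
  have l: "linear l" and c: "continuous_on UNIV l"
    using assms by (auto simp: continuous_dual_def)
  have "continuous_on UNIV (\<lambda>x. l (x, 0))" "continuous_on UNIV (\<lambda>y. l (0, y))"
    by (intro continuous_on_compose2[OF c] continuous_on_Pair continuous_on_id continuous_on_const;
        simp)+
  moreover have "linear (\<lambda>x. l (x, 0))" "linear (\<lambda>y. l (0, y))"
    using linear_add[OF l, of "(_, 0)" "(_, 0)"] linear_scale[OF l, of _ "(_, 0)"]
      linear_add[OF l, of "(0, _)" "(0, _)"] linear_scale[OF l, of _ "(0, _)"]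
    by (auto intro!: linearI)
  ultimately show "(\<lambda>x. l (x, 0)) \<in> continuous_dual" "(\<lambda>y. l (0, y)) \<in> continuous_dual"
    by (auto simp: continuous_dual_def)
  show "l (x, y) = l (x, 0) + l (0, y)"
    using linear_add[OF l, of "(x, 0)" "(0, y)"] by simp
qed

section \<open>Markov operators and closed convex hulls\<close>

lemma markov_operator_sum_ge:
  assumes S: "function_space \<Omega>1 S1" and E: "markov_operator \<Omega>1 S1 \<Omega>2 S2 E"
    and \<phi>: "\<phi> \<in> S1" and \<psi>: "\<psi> \<in> S1"
    and ge: "\<And>\<omega>. \<omega> \<in> \<Omega>1 \<Longrightarrow> k \<le> \<phi> \<omega> + \<psi> \<omega>" and \<omega>: "\<omega> \<in> \<Omega>2"
  shows "k \<le> E \<phi> \<omega> + E \<psi> \<omega>"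
proof -
  let ?one = "\<lambda>\<omega>\<in>\<Omega>1. 1 :: real"
  let ?c = "\<lambda>\<omega>\<in>\<Omega>1. - k * ?one \<omega>"
  let ?s = "\<lambda>\<omega>\<in>\<Omega>1. \<phi> \<omega> + \<psi> \<omega>"
  let ?d = "\<lambda>\<omega>\<in>\<Omega>1. ?s \<omega> + ?c \<omega>"
  have one: "?one \<in> S1"
    and addS: "\<And>\<phi> \<psi>. \<phi> \<in> S1 \<Longrightarrow> \<psi> \<in> S1 \<Longrightarrow> (\<lambda>\<omega>\<in>\<Omega>1. \<phi> \<omega> + \<psi> \<omega>) \<in> S1"
    and scaleS: "\<And>c \<phi>. \<phi> \<in> S1 \<Longrightarrow> (\<lambda>\<omega>\<in>\<Omega>1. c * \<phi> \<omega>) \<in> S1"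
    using S by (auto simp: function_space_def)
  have Eadd: "\<And>\<phi> \<psi>. \<phi> \<in> S1 \<Longrightarrow> \<psi> \<in> S1 \<Longrightarrow> E (\<lambda>\<omega>\<in>\<Omega>1. \<phi> \<omega> + \<psi> \<omega>) \<omega> = E \<phi> \<omega> + E \<psi> \<omega>"
    and Escale: "\<And>c \<phi>. \<phi> \<in> S1 \<Longrightarrow> E (\<lambda>\<omega>\<in>\<Omega>1. c * \<phi> \<omega>) \<omega> = c * E \<phi> \<omega>"
    and Eone: "E ?one \<omega> = 1"
    and Epos: "\<And>\<phi>. \<phi> \<in> S1 \<Longrightarrow> (\<And>\<omega>. \<omega> \<in> \<Omega>1 \<Longrightarrow> 0 \<le> \<phi> \<omega>) \<Longrightarrow> 0 \<le> E \<phi> \<omega>"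
    using E \<omega> by (simp_all add: markov_operator_def)
  have c: "?c \<in> S1" by (rule scaleS[OF one])
  have s: "?s \<in> S1" by (rule addS[OF \<phi> \<psi>])
  have "0 \<le> E ?d \<omega>"
  proof (rule Epos)
    show "?d \<in> S1" by (rule addS[OF s c])
  next
    fix \<omega>' assume "\<omega>' \<in> \<Omega>1"
    then show "0 \<le> ?d \<omega>'" using ge[of \<omega>'] by simp
  qed
  also have "E ?d \<omega> = (E \<phi> \<omega> + E \<psi> \<omega>) + - k * 1"
    by (simp only: Eadd[OF s c] Eadd[OF \<phi> \<psi>] Escale[OF one] Eone)
  finally show ?thesis by simp
qed

lemma valued_markov_operator_pair_in_closure:
  fixes X :: "'a \<Rightarrow> 'x::hausdorff_locally_convex" and Y :: "'a \<Rightarrow> 'y::hausdorff_locally_convex"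
  assumes S: "function_space \<Omega>1 S1" and E: "markov_operator \<Omega>1 S1 \<Omega>2 S2 E"
    and EX: "valued_markov_operator \<Omega>1 S1 S1X \<Omega>2 S2 S2X E E_X"
    and EY: "valued_markov_operator \<Omega>1 S1 S1Y \<Omega>2 S2 S2Y E E_Y"
    and X: "X \<in> S1X" and Y: "Y \<in> S1Y"
    and C: "convex C" "\<And>\<omega>. \<omega> \<in> \<Omega>1 \<Longrightarrow> (X \<omega>, Y \<omega>) \<in> C" and \<omega>: "\<omega> \<in> \<Omega>2"
  shows "(E_X X \<omega>, E_Y Y \<omega>) \<in> closure C"
proof (rule ccontr)
  let ?z = "(E_X X \<omega>, E_Y Y \<omega>)"
  assume "?z \<notin> closure C"
  then obtain l where l: "l \<in> continuous_dual" and sep: "\<And>c. c \<in> C \<Longrightarrow> l ?z + 1 \<le> l c"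
    using strict_separation[OF C(1)] by blast
  let ?l1 = "\<lambda>x. l (x, 0)" and ?l2 = "\<lambda>y. l (0, y)"
  note split = continuous_dual_prod_split[OF l]
  have in_S1: "compose \<Omega>1 ?l1 X \<in> S1" "compose \<Omega>1 ?l2 Y \<in> S1"
    using EX EY X Y split(1,2) by (auto simp: valued_markov_operator_def weak_functions_def)
  have "compose \<Omega>2 ?l1 (E_X X) = E (compose \<Omega>1 ?l1 X)"
    "compose \<Omega>2 ?l2 (E_Y Y) = E (compose \<Omega>1 ?l2 Y)"
    using EX EY X Y split(1,2) by (simp_all add: valued_markov_operator_def)
  then have val: "E (compose \<Omega>1 ?l1 X) \<omega> = l (E_X X \<omega>, 0)"
    "E (compose \<Omega>1 ?l2 Y) \<omega> = l (0, E_Y Y \<omega>)"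
    using \<omega> by (metis compose_eq)+
  have "l ?z + 1 \<le> compose \<Omega>1 ?l1 X \<omega>' + compose \<Omega>1 ?l2 Y \<omega>'" if "\<omega>' \<in> \<Omega>1" for \<omega>'
    using sep[OF C(2)[OF that]] split(3)[of "X \<omega>'" "Y \<omega>'"] that by (simp add: compose_eq)
  then have "l ?z + 1 \<le> E (compose \<Omega>1 ?l1 X) \<omega> + E (compose \<Omega>1 ?l2 Y) \<omega>"
    by (rule markov_operator_sum_ge[OF S E in_S1 _ \<omega>])
  then show False
    using split(3)[of "E_X X \<omega>" "E_Y Y \<omega>"] val by simp
qed

theorem theorem4p9:
  fixes \<Omega>1 :: "'a set" and \<Omega>2 :: "'b set"
    and S1 :: "('a \<Rightarrow> real) set" and S2 :: "('b \<Rightarrow> real) set"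
    and E :: "('a \<Rightarrow> real) \<Rightarrow> ('b \<Rightarrow> real)"
    and S1X :: "('a \<Rightarrow> 'x::hausdorff_locally_convex) set" and S2X :: "('b \<Rightarrow> 'x) set"
    and S1Y :: "('a \<Rightarrow> 'y::hausdorff_locally_convex) set" and S2Y :: "('b \<Rightarrow> 'y) set"
    and E_X :: "('a \<Rightarrow> 'x) \<Rightarrow> ('b \<Rightarrow> 'x)" and E_Y :: "('a \<Rightarrow> 'y) \<Rightarrow> ('b \<Rightarrow> 'y)"
    and rel :: "'y \<Rightarrow> 'y \<Rightarrow> bool" and rel' :: "'y extended \<Rightarrow> 'y extended \<Rightarrow> bool"
    and K :: "'x set" and f :: "'x \<Rightarrow> 'y" and X :: "'a \<Rightarrow> 'x"
    and gl gu :: "'x \<Rightarrow> 'y extended"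
  assumes "extends_relation rel rel'"
    and "function_space \<Omega>1 S1" and "function_space \<Omega>2 S2"
    and "markov_operator \<Omega>1 S1 \<Omega>2 S2 E"
    and "valued_markov_operator \<Omega>1 S1 S1X \<Omega>2 S2 S2X E E_X"
    and "valued_markov_operator \<Omega>1 S1 S1Y \<Omega>2 S2 S2Y E E_Y"
    and "X \<in> \<Omega>1 \<rightarrow> K"
    and "X \<in> S1X" and "compose \<Omega>1 f X \<in> S1Y"
    and "closure (convex hull (graph_on K f)) \<subseteq>
      {(x, y). x \<in> closure (convex hull K) \<and> rel' (gl x) (Fin y) \<and> rel' (Fin y) (gu x)}"
  shows "\<forall>\<omega>\<in>\<Omega>2. E_X X \<omega> \<in> closure (convex hull K) \<and>
      rel' (gl (E_X X \<omega>)) (Fin (E_Y (compose \<Omega>1 f X) \<omega>)) \<and>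
      rel' (Fin (E_Y (compose \<Omega>1 f X) \<omega>)) (gu (E_X X \<omega>))"
proof
  fix \<omega> assume "\<omega> \<in> \<Omega>2"
  have "(X \<omega>', compose \<Omega>1 f X \<omega>') \<in> convex hull (graph_on K f)" if "\<omega>' \<in> \<Omega>1" for \<omega>'
    using assms(7) that by (intro hull_inc) (auto simp: graph_on_def compose_eq)
  then have "(E_X X \<omega>, E_Y (compose \<Omega>1 f X) \<omega>) \<in> closure (convex hull (graph_on K f))"
    using \<open>\<omega> \<in> \<Omega>2\<close>
    by (intro valued_markov_operator_pair_in_closure[OF assms(2,4-6,8,9)]) auto
  with assms(10) show "E_X X \<omega> \<in> closure (convex hull K) \<and>
      rel' (gl (E_X X \<omega>)) (Fin (E_Y (compose \<Omega>1 f X) \<omega>)) \<and>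
      rel' (Fin (E_Y (compose \<Omega>1 f X) \<omega>)) (gu (E_X X \<omega>))"
    by blast
qed

end
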